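(* Let $M$ be a matroid of rank $r$ on a finite set $E$ and let $I_M$ be its independent set polytope. Then, as a signed Minkowski sum, \[I_M=\sum_{A\subseteq E}\widetilde\beta(M/A)\,D_{E-A},\] i.e. $I_M+\sum_{A:\,\widetilde\beta(M/A)<0}(-\widetilde\beta(M/A))D_{E-A}=\sum_{A:\,\widetilde\beta(M/A)>0}\widetilde\beta(M/A)D_{E-A}$.
   Context: The independent set polytope $I_M\subseteq\mathbb{R}^E$ is the convex hull of the indicator vectors of the independent sets of $M$. For $J\subseteq E$, $D_J=\mathrm{conv}(\{0\}\cup\{e_i:i\in J\})$. For $A\subseteq E$, $M/A$ is the contraction with rank function $r_{M/A}(X)=r(X\cup A)-r(A)$ on $E-A$. For a matroid $N$ on $S$, $\beta(N)=(-1)^{r_N(S)}\sum_{X\subseteq S}(-1)^{|X|}r_N(X)$ and $\widetilde\beta(N)=(-1)^{r_N(S)+1}\beta(N)$. Minkowski sum $P+Q=\{p+q\}$, $yQ=\{yq\}$ for $y\ge0$. *)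

theory Defs
  imports "HOL-Analysis.Analysis"
begin

record 'a matroid =
  ground :: "'a set"
  indeps :: "'a set set"

definition is_matroid :: "'a matroid \<Rightarrow> bool" where
  "is_matroid M \<longleftrightarrow>
     finite (ground M) \<and>
     (\<forall>X \<in> indeps M. X \<subseteq> ground M) \<and>
     {} \<in> indeps M \<and>
     (\<forall>X Y. X \<in> indeps M \<and> Y \<subseteq> X \<longrightarrow> Y \<in> indeps M) \<and>
     (\<forall>X Y. X \<in> indeps M \<and> Y \<in> indeps M \<and> card X < card Y
        \<longrightarrow> (\<exists>y \<in> Y - X. insert y X \<in> indeps M))"

definition mrank :: "'a matroid \<Rightarrow> 'a set \<Rightarrow> nat" where
  "mrank M X = Max (card ` {I \<in> indeps M. I \<subseteq> X})"

text \<open>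
  The contraction is the matroid on \<open>ground M - A\<close> whose rank function is
  \<open>r(X \<union> A) - r(A)\<close>; a set is independent in it iff this value equals its cardinality.
  See \<open>is_matroid_contract\<close> and \<open>mrank_contract\<close> below.
\<close>
definition contract :: "'a matroid \<Rightarrow> 'a set \<Rightarrow> 'a matroid" where
  "contract M A =
     \<lparr>ground = ground M - A,
      indeps = {X. X \<subseteq> ground M - A \<and> mrank M (X \<union> A) = card X + mrank M A}\<rparr>"

definition beta :: "'a matroid \<Rightarrow> int" where
  "beta N = (- 1) ^ mrank N (ground N) *
     (\<Sum>X \<in> Pow (ground N). (- 1) ^ card X * int (mrank N X))"

definition signed_beta :: "'a matroid \<Rightarrow> int" where
  "signed_beta N = (- 1) ^ (mrank N (ground N) + 1) * beta N"

text \<open>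
  Ground sets of the matroids below are arbitrary (possibly empty) subsets \<open>E\<close> of a
  finite type \<open>'e\<close>; \<open>\<real>\<^sup>E\<close> is the coordinate subspace of \<open>real ^ 'e\<close>
  of vectors vanishing outside \<open>E\<close>.
\<close>
definition indicator_vec :: "'e set \<Rightarrow> real ^ 'e::finite" where
  "indicator_vec X = (\<chi> i. indicator X i)"

definition indep_polytope :: "'e matroid \<Rightarrow> (real ^ 'e::finite) set" where
  "indep_polytope M = convex hull (indicator_vec ` indeps M)"

definition D_simplex :: "'e set \<Rightarrow> (real ^ 'e::finite) set" where
  "D_simplex J = convex hull ({0} \<union> (\<lambda>i. axis i 1) ` J)"

context
  fixes M :: "'a matroid"
  assumes M: "is_matroid M"
begin

private lemma fin: "finite {I \<in> indeps M. I \<subseteq> X}"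
proof (rule finite_subset)
  show "{I \<in> indeps M. I \<subseteq> X} \<subseteq> Pow (ground M)"
    using M by (auto simp: is_matroid_def)
  show "finite (Pow (ground M))"
    using M by (simp add: is_matroid_def)
qed

private lemma indep_finite: "I \<in> indeps M \<Longrightarrow> finite I"
  using M by (meson finite_subset is_matroid_def)

private lemma indep_subset: "I \<in> indeps M \<Longrightarrow> J \<subseteq> I \<Longrightarrow> J \<in> indeps M"
  using M unfolding is_matroid_def by blast

lemma mrank_ge: "I \<in> indeps M \<Longrightarrow> I \<subseteq> X \<Longrightarrow> card I \<le> mrank M X"
  unfolding mrank_def using fin[of X] by (intro Max_ge) auto

lemma mrank_obtain:
  obtains I where "I \<in> indeps M" "I \<subseteq> X" "card I = mrank M X"
proof -
  have "{} \<in> {I \<in> indeps M. I \<subseteq> X}"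
    using M by (simp add: is_matroid_def)
  then have "mrank M X \<in> card ` {I \<in> indeps M. I \<subseteq> X}"
    unfolding mrank_def using fin[of X] by (intro Max_in) auto
  then show ?thesis using that by auto
qed

lemma mrank_mono: "X \<subseteq> Y \<Longrightarrow> mrank M X \<le> mrank M Y"
  by (metis mrank_ge mrank_obtain order_trans)

lemma mrank_Un_le: 
  assumes "finite X" shows "mrank M (X \<union> Y) \<le> card X + mrank M Y"
proof -
  obtain I where I: "I \<in> indeps M" "I \<subseteq> X \<union> Y" "card I = mrank M (X \<union> Y)"
    by (rule mrank_obtain)
  have "card (I - X) \<le> mrank M Y"
    using I by (intro mrank_ge) (auto intro: indep_subset)
  moreover have "card (I \<inter> X) \<le> card X"
    using assms by (simp add: card_mono)
  moreover have "card I = card (I - X) + card (I \<inter> X)"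
    using indep_finite[OF I(1)]
    by (metis Int_commute card_Diff_subset_Int card_mono finite_Int inf_le2 le_add_diff_inverse2)
  ultimately show ?thesis using I by linarith
qed

private lemma indep_extend:
  assumes "I \<in> indeps M" "I \<subseteq> X"
  obtains B where "B \<in> indeps M" "I \<subseteq> B" "B \<subseteq> X" "card B = mrank M X"
proof -
  have "\<exists>B. B \<in> indeps M \<and> I \<subseteq> B \<and> B \<subseteq> X \<and> card B = mrank M X"
    using assms
  proof (induction "mrank M X - card I" arbitrary: I)
    case 0
    then have "card I = mrank M X" using mrank_ge[of I X] by simp
    then show ?case using 0 by blast
  next
    case (Suc n)
    obtain C where C: "C \<in> indeps M" "C \<subseteq> X" "card C = mrank M X"
      by (rule mrank_obtain)
    have "card I < card C" using Suc(2) C by linarith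
    then obtain y where y: "y \<in> C - I" "insert y I \<in> indeps M"
      using M C Suc.prems unfolding is_matroid_def by blast
    have "card (insert y I) = Suc (card I)"
      using y indep_finite[OF Suc.prems(1)] by simp
    then have "n = mrank M X - card (insert y I)" using Suc(2) by linarith
    moreover have "insert y I \<subseteq> X" using y C Suc.prems by auto
    ultimately show ?case using Suc(1) y(2) by blast
  qed
  then show ?thesis using that by blast
qed

private lemma contract_finite: "X \<in> indeps (contract M A) \<Longrightarrow> finite X"
  using M by (auto simp: contract_def is_matroid_def intro: finite_subset)

lemma is_matroid_contract: "is_matroid (contract M A)"
  unfolding is_matroid_def
proof (intro conjI allI impI ballI)
  show "finite (ground (contract M A))"
    using M by (simp add: contract_def is_matroid_def)
  show "{} \<in> indeps (contract M A)" by (simp add: contract_def)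
next
  fix X assume "X \<in> indeps (contract M A)"
  then show "X \<subseteq> ground (contract M A)" by (simp add: contract_def)
next
  fix X Y assume "X \<in> indeps (contract M A) \<and> Y \<subseteq> X"
  then have X: "X \<in> indeps (contract M A)" and Y: "Y \<subseteq> X" by auto
  have finX: "finite X" using contract_finite X by blast
  then have finY: "finite Y" using Y finite_subset by blast
  have "mrank M ((X - Y) \<union> (Y \<union> A)) \<le> card (X - Y) + mrank M (Y \<union> A)"
    using finX by (intro mrank_Un_le) auto
  moreover have "(X - Y) \<union> (Y \<union> A) = X \<union> A" using Y by auto
  moreover have "card X = card (X - Y) + card Y"
    using Y finX finY by (simp add: card_Diff_subset card_mono)
  moreover have "mrank M (Y \<union> A) \<le> card Y + mrank M A"
    using finY by (rule mrank_Un_le)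
  ultimately show "Y \<in> indeps (contract M A)"
    using X Y by (auto simp: contract_def)
next
  fix X Y
  assume "X \<in> indeps (contract M A) \<and> Y \<in> indeps (contract M A) \<and> card X < card Y"
  then have X: "X \<in> indeps (contract M A)" and Y: "Y \<in> indeps (contract M A)"
    and less: "card X < card Y" by auto
  obtain B where B: "B \<in> indeps M" "B \<subseteq> X \<union> A" "card B = mrank M (X \<union> A)"
    by (rule mrank_obtain)
  obtain C where C: "C \<in> indeps M" "C \<subseteq> Y \<union> A" "card C = mrank M (Y \<union> A)"
    by (rule mrank_obtain)
  have "card B < card C" using B C X Y less by (simp add: contract_def)
  then obtain c where c: "c \<in> C - B" "insert c B \<in> indeps M"
    using M B C unfolding is_matroid_def by blast
  have cardc: "card (insert c B) = Suc (card B)"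
    using c indep_finite[OF B(1)] by simp
  have "c \<notin> X \<union> A"
  proof
    assume "c \<in> X \<union> A"
    then have "card (insert c B) \<le> mrank M (X \<union> A)"
      using B c by (intro mrank_ge) auto
    then show False using cardc B by simp
  qed
  then have cY: "c \<in> Y - X" and "c \<notin> A" using c C by auto
  have "card (insert c B) \<le> mrank M (insert c X \<union> A)"
    using B c by (intro mrank_ge) auto
  moreover have "mrank M (insert c X \<union> A) \<le> card (insert c X) + mrank M A"
    using contract_finite[OF X] by (intro mrank_Un_le) auto
  moreover have "card (insert c X) = Suc (card X)"
    using cY contract_finite[OF X] by simp
  ultimately have "insert c X \<in> indeps (contract M A)"
    using X Y cY cardc B by (auto simp: contract_def)
  then show "\<exists>y\<in>Y - X. insert y X \<in> indeps (contract M A)" using cY by blast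
qed

lemma mrank_contract:
  assumes "X \<subseteq> ground M - A"
  shows "mrank (contract M A) X = mrank M (X \<union> A) - mrank M A"
  unfolding mrank_def[of "contract M A"]
proof (rule Max_eqI)
  have "finite X" using M assms by (auto simp: is_matroid_def intro: finite_subset)
  then have "finite {I \<in> indeps (contract M A). I \<subseteq> X}" by simp
  then show "finite (card ` {I \<in> indeps (contract M A). I \<subseteq> X})" by simp
next
  fix k assume "k \<in> card ` {I \<in> indeps (contract M A). I \<subseteq> X}"
  then obtain I where I: "k = card I" "I \<in> indeps (contract M A)" "I \<subseteq> X" by auto
  have "mrank M (I \<union> A) \<le> mrank M (X \<union> A)" using I by (intro mrank_mono) auto
  then show "k \<le> mrank M (X \<union> A) - mrank M A" using I by (simp add: contract_def)
next
  obtain B0 where B0: "B0 \<in> indeps M" "B0 \<subseteq> A" "card B0 = mrank M A"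
    by (rule mrank_obtain)
  obtain B where B: "B \<in> indeps M" "B0 \<subseteq> B" "B \<subseteq> X \<union> A" "card B = mrank M (X \<union> A)"
    using indep_extend[of B0 "X \<union> A"] B0 by blast
  have finB: "finite B" using indep_finite B by blast
  have "card B0 \<le> card (B \<inter> A)" using B B0 finB by (intro card_mono) auto
  moreover have "card (B \<inter> A) \<le> mrank M A"
    using B indep_subset by (intro mrank_ge) auto
  moreover have "card B = card (B - A) + card (B \<inter> A)"
    using finB by (metis Diff_disjoint Int_Diff_disjoint Un_Diff_Int add.commute
        card_Un_disjoint finite_Diff finite_Int inf_commute)
  ultimately have cardB: "mrank M (X \<union> A) = card (B - A) + mrank M A"
    using B B0 by linarith
  have "card B \<le> mrank M ((B - A) \<union> A)" using B by (intro mrank_ge) auto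
  moreover have "mrank M ((B - A) \<union> A) \<le> card (B - A) + mrank M A"
    using finB by (intro mrank_Un_le) auto
  ultimately have "B - A \<in> indeps (contract M A)"
    using B cardB assms by (auto simp: contract_def)
  moreover have "B - A \<subseteq> X" using B by auto
  ultimately show "mrank M (X \<union> A) - mrank M A \<in> card ` {I \<in> indeps (contract M A). I \<subseteq> X}"
    using cardB by (intro image_eqI[of _ _ "B - A"]) auto
qed

end

end

theory Submission
  imports Defs
begin

text \<open>
  Compact convex sets are determined by their support functions, and support functions are
  additive under Minkowski sums. Write the positive part of a weight as a nonnegative
  combination of indicator functions of a chain of sets \<open>S\<close>. By the greedy algorithm, the
  maximum of the weight over an independent set polytope is the same combination of the ranks
  of the \<open>S\<close>. The simplex \<open>D\<^sub>J\<close> is itself an independent set polytope, of a matroid in which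
  \<open>S\<close> has rank 1 or 0 according to whether \<open>S\<close> meets \<open>J\<close>. So it suffices that \<open>r(S)\<close> is the
  sum of the signed beta invariants of \<open>M/A\<close> over the \<open>A\<close> not containing \<open>S\<close>, which is
  Moebius inversion.
\<close>

section \<open>Support functions and Minkowski sums\<close>

text \<open>The support function as a relation: \<open>m\<close> is its value at \<open>w\<close>
  and some point of \<open>K\<close> attains it. Attainment carries nonemptiness and boundedness in
  direction \<open>w\<close>, so no supremum has to be justified.\<close>

definition attains_max :: "'a::real_inner set \<Rightarrow> 'a \<Rightarrow> real \<Rightarrow> bool" where
  "attains_max K w m \<longleftrightarrow> (\<exists>x\<in>K. inner w x = m) \<and> (\<forall>x\<in>K. inner w x \<le> m)"

lemma attains_max_plus:
  assumes "attains_max K w a" "attains_max L w b"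
  shows "attains_max (K + L) w (a + b)"
proof -
  obtain x y where "x \<in> K" "y \<in> L" "inner w x = a" "inner w y = b"
    using assms by (auto simp: attains_max_def)
  then have "x + y \<in> K + L" "inner w (x + y) = a + b"
    by (auto simp: inner_add_right)
  moreover have "inner w z \<le> a + b" if "z \<in> K + L" for z
    using that assms
    by (auto simp: attains_max_def inner_add_right intro!: add_mono elim!: set_plus_elim)
  ultimately show ?thesis unfolding attains_max_def by blast
qed

lemma attains_max_sum:
  assumes "finite I" "\<And>i. i \<in> I \<Longrightarrow> attains_max (K i) w (m i)"
  shows "attains_max (\<Sum>i\<in>I. K i) w (\<Sum>i\<in>I. m i)"
  using assms
  by (induction I rule: finite_induct) (auto simp: attains_max_plus, simp add: attains_max_def)

lemma attains_max_scaleR: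
  assumes "attains_max K w m" "0 \<le> c"
  shows "attains_max ((\<lambda>x. c *\<^sub>R x) ` K) w (c * m)"
  using assms by (auto simp: attains_max_def mult_left_mono)

lemma attains_max_convex_hull:
  assumes "attains_max K w m"
  shows "attains_max (convex hull K) w m"
proof -
  have "convex hull K \<subseteq> {x. inner w x \<le> m}"
    using assms by (intro hull_minimal) (auto simp: attains_max_def convex_halfspace_le)
  then show ?thesis
    using assms hull_subset[of K convex] unfolding attains_max_def by blast
qed

text \<open>A point of \<open>K\<close> outside \<open>L\<close> would be strictly separated from
  \<open>L\<close> by a hyperplane, and in the direction of its normal the maximum over
  \<open>K\<close> would exceed the maximum over \<open>L\<close>.\<close>

lemma subset_if_attains_max:
  fixes K L :: "'a::euclidean_space set"
  assumes "convex L" "closed L" "\<And>w. \<exists>m. attains_max K w m \<and> attains_max L w m"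
  shows "K \<subseteq> L"
proof
  fix z assume z: "z \<in> K"
  show "z \<in> L"
  proof (rule ccontr)
    assume "z \<notin> L"
    then obtain a b where ab: "inner a z < b" "\<And>x. x \<in> L \<Longrightarrow> inner a x > b"
      using separating_hyperplane_closed_point[OF assms(1,2)] by metis
    \<comment> \<open>The separation puts \<open>L\<close> on the side of larger values of
      \<open>a\<close>, so the direction in which \<open>z\<close> beats all of \<open>L\<close> is
      \<open>- a\<close>.\<close>
    obtain m where m: "attains_max K (- a) m" "attains_max L (- a) m"
      using assms(3) by blast
    then obtain x where "x \<in> L" "inner (- a) x = m" by (auto simp: attains_max_def)
    moreover have "inner (- a) z \<le> m" using m z by (auto simp: attains_max_def)
    ultimately show False using ab(1) ab(2)[of x] by simp
  qed
qed

lemma eq_if_attains_max: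
  fixes K L :: "'a::euclidean_space set"
  assumes "convex K" "compact K" "convex L" "compact L"
    and "\<And>w. \<exists>m. attains_max K w m \<and> attains_max L w m"
  shows "K = L"
  using assms subset_if_attains_max[of L K] subset_if_attains_max[of K L]
  by (auto simp: compact_imp_closed)

lemma compact_set_plus:
  fixes K L :: "'a::real_normed_vector set"
  assumes "compact K" "compact L"
  shows "compact (K + L)"
proof -
  have "K + L = {x + y | x y. x \<in> K \<and> y \<in> L}" by (auto simp: set_plus_def)
  then show ?thesis using compact_sums[OF assms] by simp
qed

lemma compact_set_sum:
  fixes K :: "'i \<Rightarrow> 'a::real_normed_vector set"
  assumes "\<And>i. i \<in> I \<Longrightarrow> compact (K i)"
  shows "compact (\<Sum>i\<in>I. K i)"
  using assms by (induction I rule: infinite_finite_induct) (auto simp: compact_set_plus)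

section \<open>Chain decompositions of weights\<close>

text \<open>The layer-cake decomposition of the positive part of \<open>w\<close>. Confining the
  layers to the support of the positive part ensures that a set chosen inside their union collects
  no nonpositive weight.\<close>

definition chain_decomposition :: "'e set \<Rightarrow> ('e \<Rightarrow> real) \<Rightarrow> 'e set set \<Rightarrow> ('e set \<Rightarrow> real) \<Rightarrow> bool"
  where "chain_decomposition E w C c \<longleftrightarrow>
    finite C \<and> (\<forall>S\<in>C. \<forall>T\<in>C. S \<subseteq> T \<or> T \<subseteq> S) \<and>
    (\<forall>S\<in>C. 0 \<le> c S \<and> S \<subseteq> {i \<in> E. 0 < w i}) \<and>
    (\<forall>i\<in>E. max 0 (w i) = (\<Sum>S\<in>C. c S * indicator S i))"

text \<open>The bottom layer is the whole positive support \<open>S\<close>, with the least positive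
  weight as its coefficient. Subtracting it on \<open>S\<close> shrinks the support, so the
  remaining layers come from the induction hypothesis.\<close>

lemma chain_decomposition_exists:
  assumes "finite E"
  shows "\<exists>C c. chain_decomposition E w C c"
proof (induction "card {i \<in> E. 0 < w i}" arbitrary: w rule: less_induct)
  case less
  define S where "S = {i \<in> E. 0 < w i}"
  have finS: "finite S" using assms by (simp add: S_def)
  show ?case
  proof (cases "S = {}")
    case True
    then have "chain_decomposition E w {} (\<lambda>_. 0)"
      by (auto simp: chain_decomposition_def S_def max_def)
    then show ?thesis by blast
  next
    case False
    define m where "m = Min (w ` S)"
    obtain j where j: "j \<in> S" "w j = m"
      using Min_in[of "w ` S"] finS False unfolding m_def by fastforce
    then have m: "m > 0" by (auto simp: S_def)
    have mle: "m \<le> w i" if "i \<in> S" for i using finS that by (simp add: m_def)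
    define w' where "w' i = (if i \<in> S then w i - m else w i)" for i
    have "{i \<in> E. 0 < w' i} \<subseteq> S - {j}" using j by (auto simp: w'_def S_def)
    \<comment> \<open>The element \<open>j\<close> attaining the minimum drops to weight 0. This
      gives the descent, and it keeps \<open>S\<close> out of the smaller chain, so that the update
      of \<open>c\<close> at \<open>S\<close> leaves the old coefficients alone.\<close>
    moreover from this have "card {i \<in> E. 0 < w' i} < card S"
      using j finS by (intro psubset_card_mono) auto
    then obtain C c where C: "chain_decomposition E w' C c"
      using less[of w'] by (auto simp: S_def)
    ultimately have CS: "T \<subseteq> S - {j}" if "T \<in> C" for T
      using that unfolding chain_decomposition_def by blast
    then have SC: "S \<notin> C" using j by blast
    have finC: "finite C" using C by (simp add: chain_decomposition_def)
    have "\<forall>i\<in>E. max 0 (w i) = (\<Sum>T\<in>insert S C. (c(S := m)) T * indicator T i)"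
    proof
      fix i assume i: "i \<in> E"
      have "(\<Sum>T\<in>C. (c(S := m)) T * indicator T i) = (\<Sum>T\<in>C. c T * indicator T i)"
        using SC by (intro sum.cong) auto
      also have "\<dots> = max 0 (w' i)" using C i by (simp add: chain_decomposition_def)
      finally have "(\<Sum>T\<in>insert S C. (c(S := m)) T * indicator T i)
          = m * indicator S i + max 0 (w' i)"
        unfolding sum.insert[OF finC SC] by (simp only: fun_upd_same)
      \<comment> \<open>On \<open>S\<close> the truncation of \<open>w' i\<close> is harmless
        because \<open>m\<close> is at most \<open>w i\<close>; off \<open>S\<close> the weight is
        unchanged and nonpositive.\<close>
      also have "\<dots> = max 0 (w i)"
        using i m mle[of i] by (cases "i \<in> S") (auto simp: w'_def S_def)
      finally show "max 0 (w i) = (\<Sum>T\<in>insert S C. (c(S := m)) T * indicator T i)" ..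
    qed
    moreover have "\<forall>T\<in>insert S C. 0 \<le> (c(S := m)) T \<and> T \<subseteq> {i \<in> E. 0 < w i}"
      using C CS m by (auto simp: chain_decomposition_def S_def)
    moreover have "\<forall>T\<in>insert S C. \<forall>U\<in>insert S C. T \<subseteq> U \<or> U \<subseteq> T"
      using C CS unfolding chain_decomposition_def by blast
    ultimately have "chain_decomposition E w (insert S C) (c(S := m))"
      unfolding chain_decomposition_def using finC by (intro conjI finite.insertI)
    then show ?thesis by blast
  qed
qed

section \<open>The greedy algorithm on independent set polytopes\<close>

lemma indep_extends_to_basis:
  assumes M: "is_matroid M" and "I \<in> indeps M" "I \<subseteq> X"
  shows "\<exists>B\<in>indeps M. I \<subseteq> B \<and> B \<subseteq> X \<and> card B = mrank M X"
  using assms(2,3)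
proof (induction "mrank M X - card I" arbitrary: I rule: less_induct)
  case less
  obtain C where C: "C \<in> indeps M" "C \<subseteq> X" "card C = mrank M X"
    by (rule mrank_obtain[OF M])
  show ?case
  proof (cases "card I < card C")
    case True
    then obtain y where y: "y \<in> C - I" "insert y I \<in> indeps M"
      using M C less.prems unfolding is_matroid_def by blast
    have "finite I" using M less.prems by (meson finite_subset is_matroid_def)
    then have "card (insert y I) = Suc (card I)" using y by simp
    then have "mrank M X - card (insert y I) < mrank M X - card I"
      using True C by linarith
    then show ?thesis using less.hyps[of "insert y I"] y C less.prems by blast
  next
    case False
    then show ?thesis using C less.prems mrank_ge[OF M, of I X] by force
  qed
qed

text \<open>This is the greedy algorithm run from the smallest set upwards: a set \<open>I\<close>
  that works for the chain without its largest member \<open>S\<close> is extended to a basis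
  \<open>B\<close> of \<open>S\<close>. For smaller \<open>T\<close> the trace on \<open>T\<close>
  can only grow, yet it is independent and so already has the largest possible size.\<close>

lemma chain_has_common_basis:
  assumes M: "is_matroid M" and "finite C" "\<forall>S\<in>C. \<forall>T\<in>C. S \<subseteq> T \<or> T \<subseteq> S"
  shows "\<exists>I\<in>indeps M. I \<subseteq> \<Union>C \<and> (\<forall>S\<in>C. card (I \<inter> S) = mrank M S)"
  using assms(2,3)
proof (induction "card C" arbitrary: C)
  case 0
  then show ?case using M by (auto simp: is_matroid_def)
next
  case (Suc n)
  have "C \<noteq> {}" using Suc by auto
  then obtain S where S: "S \<in> C" "\<forall>T\<in>C. S \<subseteq> T \<longrightarrow> S = T"
    using finite_has_maximal[of C] Suc.prems by blast
  then have TS: "T \<subseteq> S" if "T \<in> C" for T using that Suc.prems by blast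
  have "n = card (C - {S})" using Suc S by simp
  then obtain I where I: "I \<in> indeps M" "I \<subseteq> \<Union>(C - {S})"
      "\<forall>T\<in>C - {S}. card (I \<inter> T) = mrank M T"
    using Suc.hyps(1)[of "C - {S}"] Suc.prems by auto
  then have "I \<subseteq> S" using TS by blast
  then obtain B where B: "B \<in> indeps M" "I \<subseteq> B" "B \<subseteq> S" "card B = mrank M S"
    using indep_extends_to_basis[OF M I(1)] by blast
  have finB: "finite B" using M B by (meson finite_subset is_matroid_def)
  have "card (B \<inter> T) = mrank M T" if T: "T \<in> C" for T
  proof (cases "T = S")
    case True
    then show ?thesis using B by (simp add: Int_absorb2)
  next
    case False
    then have "mrank M T \<le> card (B \<inter> T)"
      using I T B finB card_mono[of "B \<inter> T" "I \<inter> T"] by auto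
    moreover have "B \<inter> T \<in> indeps M" using M B unfolding is_matroid_def by blast
    then have "card (B \<inter> T) \<le> mrank M T" by (rule mrank_ge[OF M]) simp
    ultimately show ?thesis by simp
  qed
  then show ?case using B S by blast
qed

lemma inner_indicator_vec:
  fixes w :: "real ^ 'e::finite"
  shows "inner w (indicator_vec X) = (\<Sum>i\<in>X. w $ i)"
proof -
  have "inner w (indicator_vec X) = (\<Sum>i\<in>UNIV. w $ i * indicator X i)"
    by (simp add: inner_vec_def indicator_vec_def)
  also have "\<dots> = (\<Sum>i\<in>X. w $ i)" by (simp add: indicator_def if_distrib sum.If_cases)
  finally show ?thesis .
qed

lemma sum_max_eq_chain_sum:
  assumes "chain_decomposition E w C c" "I \<subseteq> E" "finite I"
  shows "(\<Sum>i\<in>I. max 0 (w i)) = (\<Sum>S\<in>C. c S * card (I \<inter> S))"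
proof -
  have "(\<Sum>i\<in>I. max 0 (w i)) = (\<Sum>i\<in>I. \<Sum>S\<in>C. c S * indicator S i)"
    using assms by (intro sum.cong) (auto simp: chain_decomposition_def)
  also have "\<dots> = (\<Sum>S\<in>C. \<Sum>i\<in>I. c S * indicator S i)" by (rule sum.swap)
  also have "\<dots> = (\<Sum>S\<in>C. c S * card (I \<inter> S))"
    using assms(3) by (simp add: sum_distrib_left[symmetric] indicator_def sum.If_cases)
  finally show ?thesis .
qed

text \<open>Each independent set meets \<open>S\<close> in at most \<open>mrank M S\<close>
  elements, which bounds its weight; a common basis of the chain makes all these bounds tight at
  once. The ground set may be smaller than \<open>E\<close>, so one decomposition serves several
  matroids.\<close>

lemma attains_max_indep_polytope:
  fixes w :: "real ^ 'e::finite"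
  assumes M: "is_matroid M" and E: "ground M \<subseteq> E"
    and C: "chain_decomposition E (\<lambda>i. w $ i) C c"
  shows "attains_max (indep_polytope M) w (\<Sum>S\<in>C. c S * real (mrank M S))"
  unfolding indep_polytope_def
proof (rule attains_max_convex_hull)
  have sub: "I \<subseteq> E" if "I \<in> indeps M" for I
    using that M E unfolding is_matroid_def by blast
  obtain B where B: "B \<in> indeps M" "B \<subseteq> \<Union>C" "\<forall>S\<in>C. card (B \<inter> S) = mrank M S"
    using chain_has_common_basis[OF M, of C] C unfolding chain_decomposition_def by metis
  have "\<Union>C \<subseteq> {i. 0 < w $ i}" using C by (auto simp: chain_decomposition_def)
  then have "\<forall>i\<in>B. 0 < w $ i" using B(2) by blast
  then have "(\<Sum>i\<in>B. w $ i) = (\<Sum>i\<in>B. max 0 (w $ i))"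
    by (intro sum.cong) auto
  also have "\<dots> = (\<Sum>S\<in>C. c S * real (mrank M S))"
    using sum_max_eq_chain_sum[OF C sub[OF B(1)]] B by simp
  finally have attained: "inner w (indicator_vec B) = (\<Sum>S\<in>C. c S * real (mrank M S))"
    by (simp add: inner_indicator_vec)
  have "inner w (indicator_vec I) \<le> (\<Sum>S\<in>C. c S * real (mrank M S))"
    if I: "I \<in> indeps M" for I
  proof -
    have "card (I \<inter> S) \<le> mrank M S" for S
    proof (rule mrank_ge[OF M])
      show "I \<inter> S \<in> indeps M" using M I unfolding is_matroid_def by blast
    qed simp
    then have "(\<Sum>S\<in>C. c S * card (I \<inter> S)) \<le> (\<Sum>S\<in>C. c S * real (mrank M S))"
      using C by (intro sum_mono mult_left_mono) (auto simp: chain_decomposition_def)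
    moreover have "(\<Sum>i\<in>I. w $ i) \<le> (\<Sum>i\<in>I. max 0 (w $ i))" by (intro sum_mono) simp
    ultimately show ?thesis
      using sum_max_eq_chain_sum[OF C sub[OF I]] by (simp add: inner_indicator_vec)
  qed
  then show "attains_max (indicator_vec ` indeps M) w (\<Sum>S\<in>C. c S * real (mrank M S))"
    using attained B(1) unfolding attains_max_def by blast
qed

section \<open>Simplices as independent set polytopes\<close>

text \<open>The uniform matroid of rank one on \<open>J\<close>, or of rank zero if \<open>J\<close>
  is empty. It lets the greedy result cover the simplices too.\<close>

definition rank_one_matroid :: "'a set \<Rightarrow> 'a matroid" where
  "rank_one_matroid J = \<lparr>ground = J, indeps = insert {} ((\<lambda>i. {i}) ` J)\<rparr>"

lemma is_matroid_rank_one_matroid: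
  assumes "finite J"
  shows "is_matroid (rank_one_matroid J)"
  using assms unfolding is_matroid_def rank_one_matroid_def by (auto simp: subset_singleton_iff)

lemma mrank_rank_one_matroid:
  "mrank (rank_one_matroid J) S = (if J \<inter> S = {} then 0 else 1)"
proof (cases "J \<inter> S = {}")
  case True
  then have "{I \<in> indeps (rank_one_matroid J). I \<subseteq> S} = {{}}"
    by (auto simp: rank_one_matroid_def)
  then show ?thesis using True by (simp add: mrank_def)
next
  case False
  have "{I \<in> indeps (rank_one_matroid J). I \<subseteq> S} = insert {} ((\<lambda>i. {i}) ` (J \<inter> S))"
    by (auto simp: rank_one_matroid_def)
  then have "card ` {I \<in> indeps (rank_one_matroid J). I \<subseteq> S} = {0, 1}"
    using False by (simp add: image_image image_constant_conv)
  then show ?thesis using False by (simp add: mrank_def)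
qed

lemma D_simplex_eq_indep_polytope: "D_simplex J = indep_polytope (rank_one_matroid J)"
proof -
  have "indicator_vec {} = (0 :: real ^ 'a)" by (simp add: indicator_vec_def vec_eq_iff)
  moreover have "indicator_vec {i} = (axis i 1 :: real ^ 'a)" for i
    by (simp add: indicator_vec_def vec_eq_iff axis_def)
  ultimately show ?thesis
    by (simp add: D_simplex_def indep_polytope_def rank_one_matroid_def image_image)
qed

lemma attains_max_D_simplex:
  fixes w :: "real ^ 'e::finite"
  assumes "J \<subseteq> E" "chain_decomposition E (\<lambda>i. w $ i) C c"
  shows "attains_max (D_simplex J) w (\<Sum>S\<in>C. c S * (if J \<inter> S = {} then 0 else 1))"
proof -
  have "attains_max (D_simplex J) w (\<Sum>S\<in>C. c S * real (mrank (rank_one_matroid J) S))"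
    unfolding D_simplex_eq_indep_polytope using assms
    by (intro attains_max_indep_polytope is_matroid_rank_one_matroid)
       (auto simp: rank_one_matroid_def)
  then show ?thesis by (simp add: mrank_rank_one_matroid if_distrib cong: if_cong)
qed

section \<open>Moebius inversion for signed beta invariants\<close>

lemma sum_neg_one_power_card_Pow:
  assumes "finite J" "J \<noteq> {}"
  shows "(\<Sum>X\<in>Pow J. (- 1) ^ card X) = (0 :: int)"
  using assms card_subsupersets_even_odd[of J "{}"] by (intro sum_alternating_cancels) auto

text \<open>For \<open>J = {}\<close> the left side vanishes but the right side is minus the rank of \<open>M\<close>.\<close>
lemma signed_beta_contract:
  assumes M: "is_matroid M" and J: "J \<subseteq> ground M" "J \<noteq> {}"
  shows "signed_beta (contract M (ground M - J))
    = - ((- 1) ^ card J * (\<Sum>T\<in>Pow J. (- 1) ^ card T * int (mrank M (ground M - T))))"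
proof -
  let ?E = "ground M" and ?N = "contract M (ground M - J)"
  have finJ: "finite J" using M J(1) by (meson finite_subset is_matroid_def)
  have ground: "ground ?N = J" using J by (auto simp: contract_def)
  \<comment> \<open>The sign in \<open>signed_beta\<close> and the one in \<open>beta\<close> have
    exponents differing by one, so together they leave a single minus.\<close>
  have "signed_beta ?N = - (\<Sum>X\<in>Pow J. (- 1) ^ card X * int (mrank ?N X))"
    unfolding signed_beta_def beta_def ground mult.assoc[symmetric] power_add[symmetric] by simp
  also have "(\<Sum>X\<in>Pow J. (- 1) ^ card X * int (mrank ?N X))
    = (\<Sum>X\<in>Pow J. (- 1) ^ card X * int (mrank M (X \<union> (?E - J)))
        - (- 1) ^ card X * int (mrank M (?E - J)))"
  proof (rule sum.cong)
    fix X assume "X \<in> Pow J"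
    then have "mrank ?N X = mrank M (X \<union> (?E - J)) - mrank M (?E - J)"
      using J by (intro mrank_contract[OF M]) auto
    moreover have "mrank M (?E - J) \<le> mrank M (X \<union> (?E - J))"
      by (rule mrank_mono[OF M]) simp
    ultimately show "(- 1) ^ card X * int (mrank ?N X)
      = (- 1) ^ card X * int (mrank M (X \<union> (?E - J))) - (- 1) ^ card X * int (mrank M (?E - J))"
      by (simp add: of_nat_diff right_diff_distrib)
  qed simp
  \<comment> \<open>The subtracted rank does not depend on \<open>X\<close>, and the alternating sum
    over subsets of a nonempty set vanishes.\<close>
  also have "\<dots> = (\<Sum>X\<in>Pow J. (- 1) ^ card X * int (mrank M (X \<union> (?E - J))))"
    using sum_neg_one_power_card_Pow[OF finJ J(2)]
    by (simp add: sum_subtractf flip: sum_distrib_right)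
  also have "\<dots> = (\<Sum>T\<in>Pow J. (- 1) ^ card J * ((- 1) ^ card T * int (mrank M (?E - T))))"
  proof (rule sum.reindex_bij_witness[of _ "\<lambda>T. J - T" "\<lambda>T. J - T"])
    fix X assume X: "X \<in> Pow J"
    have "card J = card X + card (J - X)"
      using X finJ by (simp add: card_Diff_subset card_mono finite_subset)
    then have "(- 1 :: int) ^ card J * (- 1) ^ card (J - X) = (- 1) ^ card X"
      by (simp add: power_add flip: power_mult_distrib)
    moreover have "?E - (J - X) = X \<union> (?E - J)" using X J by auto
    ultimately show "(- 1) ^ card J * ((- 1) ^ card (J - X) * int (mrank M (?E - (J - X))))
      = (- 1) ^ card X * int (mrank M (X \<union> (?E - J)))"
      by (simp flip: mult.assoc)
  qed (use J in auto)
  finally show ?thesis by (simp add: sum_distrib_left)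
qed

lemma mrank_empty:
  assumes "is_matroid M"
  shows "mrank M {} = 0"
proof -
  have "{I \<in> indeps M. I \<subseteq> {}} = {{}}" using assms by (auto simp: is_matroid_def)
  then show ?thesis by (simp add: mrank_def)
qed

text \<open>Provides the term for \<open>J = {}\<close>, where the formula of
  \<open>signed_beta_contract\<close> fails.\<close>

lemma signed_beta_contract_ground: "signed_beta (contract M (ground M)) = 0"
proof -
  have "{I \<in> indeps (contract M (ground M)). I \<subseteq> {}} = {{}}" by (auto simp: contract_def)
  then have "mrank (contract M (ground M)) {} = 0" by (simp add: mrank_def)
  then show ?thesis by (simp add: signed_beta_def beta_def contract_def)
qed

text \<open>Up to sign, the invariants for nonempty \<open>J\<close> are the terms of the Moebius
  inversion that recovers the function sending \<open>T\<close> to the rank of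
  \<open>ground M - T\<close>. The empty set contributes the full rank instead.\<close>

lemma sum_signed_beta_contract_subsets:
  assumes M: "is_matroid M" and S: "S \<subseteq> ground M"
  shows "(\<Sum>J\<in>Pow S. signed_beta (contract M (ground M - J)))
    = int (mrank M (ground M)) - int (mrank M (ground M - S))"
proof -
  let ?r = "\<lambda>T. int (mrank M (ground M - T))"
  define g where "g J = (\<Sum>T\<in>Pow J. (- 1) ^ card T * ?r T)" for J
  have finS: "finite S" using M S by (meson finite_subset is_matroid_def)
  have Pow: "Pow S = insert {} (Pow S - {{}})" by auto
  have fin: "finite (Pow S - {{}})" using finS by simp
  have "?r S = (\<Sum>J\<in>Pow S. (- 1) ^ card J * g J)"
    by (rule inclusion_exclusion_symmetric) (use finS in \<open>auto simp: g_def\<close>)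
  also have "\<dots> = g {} + (\<Sum>J\<in>Pow S - {{}}. (- 1) ^ card J * g J)"
    by (subst Pow, subst sum.insert) (use fin in auto)
  also have "(\<Sum>J\<in>Pow S - {{}}. (- 1) ^ card J * g J)
      = - (\<Sum>J\<in>Pow S - {{}}. signed_beta (contract M (ground M - J)))"
    unfolding sum_negf[symmetric] g_def
  proof (rule sum.cong)
    fix J assume "J \<in> Pow S - {{}}"
    then have "J \<subseteq> ground M" "J \<noteq> {}" using S by auto
    from signed_beta_contract[OF M this]
    show "(- 1) ^ card J * (\<Sum>T\<in>Pow J. (- 1) ^ card T * ?r T)
        = - signed_beta (contract M (ground M - J))" by simp
  qed simp
  also have "(\<Sum>J\<in>Pow S - {{}}. signed_beta (contract M (ground M - J)))
      = (\<Sum>J\<in>Pow S. signed_beta (contract M (ground M - J)))"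
    using finS by (intro sum.mono_neutral_left) (auto simp: signed_beta_contract_ground)
  finally show ?thesis by (simp add: g_def)
qed

text \<open>The sets \<open>J\<close> that meet \<open>S\<close> are all subsets of the ground set
  except those of its complement \<open>?E - S\<close>; the subset sum is evaluated for both and
  subtracted.\<close>

lemma mrank_eq_sum_signed_beta:
  assumes M: "is_matroid M" and S: "S \<subseteq> ground M"
  shows "int (mrank M S) = (\<Sum>A\<in>Pow (ground M).
    signed_beta (contract M A) * (if (ground M - A) \<inter> S = {} then 0 else 1))"
proof -
  let ?E = "ground M" and ?b = "\<lambda>J. signed_beta (contract M (ground M - J))"
  have fin: "finite ?E" using M by (simp add: is_matroid_def)
  have "int (mrank M S) = (\<Sum>J\<in>Pow ?E. ?b J) - (\<Sum>J\<in>Pow (?E - S). ?b J)"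
    using S by (simp add: sum_signed_beta_contract_subsets[OF M] mrank_empty[OF M] double_diff)
  also have "\<dots> = (\<Sum>J\<in>Pow ?E - Pow (?E - S). ?b J)"
    using fin by (intro sum_diff[symmetric]) auto
  also have "\<dots> = (\<Sum>J\<in>Pow ?E. ?b J * (if J \<inter> S = {} then 0 else 1))"
    using fin by (intro sum.mono_neutral_cong_left) auto
  also have "\<dots> = (\<Sum>A\<in>Pow ?E. signed_beta (contract M A) * (if (?E - A) \<inter> S = {} then 0 else 1))"
    by (rule sum.reindex_bij_witness[of _ "\<lambda>A. ?E - A" "\<lambda>A. ?E - A"])
       (auto simp: double_diff)
  finally show ?thesis .
qed

section \<open>Comparison of the support functions of both sides\<close>

theorem theorem4p4:
  fixes M :: "'e::finite matroid" and E :: "'e set" and r :: nat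
  assumes "is_matroid M"
    and "ground M = E"
    and "mrank M E = r"
  shows "indep_polytope M
       + (\<Sum>A \<in> {A. A \<subseteq> E \<and> signed_beta (contract M A) < 0}.
            (\<lambda>x. (- real_of_int (signed_beta (contract M A))) *\<^sub>R x) ` D_simplex (E - A))
       = (\<Sum>A \<in> {A. A \<subseteq> E \<and> signed_beta (contract M A) > 0}.
            (\<lambda>x. real_of_int (signed_beta (contract M A)) *\<^sub>R x) ` D_simplex (E - A))"
    (is "?I + (\<Sum>A\<in>?neg. ?K A) = (\<Sum>A\<in>?pos. ?L A)")
proof (rule eq_if_attains_max)
  have D: "convex (D_simplex J)" "compact (D_simplex J)" for J :: "'e set"
    unfolding D_simplex_def
    by (auto intro!: finite_imp_compact_convex_hull)
  have I: "convex ?I" "compact ?I"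
    unfolding indep_polytope_def by (auto intro!: finite_imp_compact_convex_hull)
  show "convex (?I + (\<Sum>A\<in>?neg. ?K A))" "convex (\<Sum>A\<in>?pos. ?L A)"
    by (intro convex_set_plus convex_set_sum convex_scaling I D)+
  show "compact (?I + (\<Sum>A\<in>?neg. ?K A))" "compact (\<Sum>A\<in>?pos. ?L A)"
    by (intro compact_set_plus compact_set_sum compact_scaling I D)+
  fix w :: "real ^ 'e"
  let ?b = "\<lambda>A. real_of_int (signed_beta (contract M A))"
  obtain C c where C: "chain_decomposition E (\<lambda>i. w $ i) C c"
    using chain_decomposition_exists[of E] by (metis finite)
  define h where "h A = (\<Sum>S\<in>C. c S * (if (E - A) \<inter> S = {} then 0 else 1))" for A
  define m where "m = (\<Sum>S\<in>C. c S * real (mrank M S))"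
  have h: "attains_max (D_simplex (E - A)) w (h A)" for A
    unfolding h_def using C by (intro attains_max_D_simplex) auto
  \<comment> \<open>The rank identity is applied layer by layer; weighting by \<open>c S\<close> and
    exchanging the sums turns it into an identity between support functions.\<close>
  have "real (mrank M S) = (\<Sum>A\<in>Pow E. ?b A * (if (E - A) \<inter> S = {} then 0 else 1))"
    if "S \<in> C" for S
  proof -
    have "S \<subseteq> ground M" using C that assms(2) by (auto simp: chain_decomposition_def)
    from arg_cong[OF mrank_eq_sum_signed_beta[OF assms(1) this], of real_of_int]
    show ?thesis using assms(2) by (simp add: if_distrib cong: if_cong)
  qed
  then have "m = (\<Sum>S\<in>C. \<Sum>A\<in>Pow E. ?b A * (c S * (if (E - A) \<inter> S = {} then 0 else 1)))"
    unfolding m_def by (intro sum.cong) (auto simp: sum_distrib_left intro!: sum.cong)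
  also have "\<dots> = (\<Sum>A\<in>Pow E. ?b A * h A)"
    unfolding h_def sum_distrib_left by (rule sum.swap)
  also have "\<dots> = (\<Sum>A\<in>?pos \<union> ?neg. ?b A * h A)"
    by (intro sum.mono_neutral_right) auto
  also have "\<dots> = (\<Sum>A\<in>?pos. ?b A * h A) + (\<Sum>A\<in>?neg. ?b A * h A)"
    by (intro sum.union_disjoint) auto
  \<comment> \<open>Moving the negative terms to the left makes every coefficient nonnegative, as
    scaling a support function requires.\<close>
  finally have m: "m + (\<Sum>A\<in>?neg. - ?b A * h A) = (\<Sum>A\<in>?pos. ?b A * h A)"
    by (simp add: sum_negf)
  have "attains_max (?I + (\<Sum>A\<in>?neg. ?K A)) w (m + (\<Sum>A\<in>?neg. - ?b A * h A))"
    unfolding m_def using C assms h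
    by (intro attains_max_plus attains_max_sum attains_max_scaleR attains_max_indep_polytope) auto
  moreover have "attains_max (\<Sum>A\<in>?pos. ?L A) w (\<Sum>A\<in>?pos. ?b A * h A)"
    using h by (intro attains_max_sum attains_max_scaleR) auto
  ultimately show "\<exists>x. attains_max (?I + (\<Sum>A\<in>?neg. ?K A)) w x
      \<and> attains_max (\<Sum>A\<in>?pos. ?L A) w x"
    using m by auto
qed

end
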